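(* Let $k\in\mathbb{Z}$, let $n\ge0$ be an integer, let $x\in\mathbb{R}$, and let $a,b,c$ be positive reals with $a\ne b$, $b>a$ and $ab\neq1$. Then $$B_n^{(k)}(x;a,b,c)=\sum_{l=0}^{n}\binom{n}{l}(\ln c)^{n-l}(\ln a+\ln b)^l\,B_l^{(k)}\!\left(\frac{-\ln b}{\ln a+\ln b}\right)x^{n-l},$$ and $$B_n^{(k)}(x;a,b,c)=\sum_{l=0}^{n}\sum_{j=0}^{l}(-1)^{l-j}\binom{n}{l}\binom{l}{j}(\ln c)^{n-l}(\ln b)^{l-j}(\ln a+\ln b)^j\,B_j^{(k)}\,x^{n-l}.$$
   Context: For $k\in\mathbb{Z}$ and $|z|<1$ let $\mathrm{Li}_k(z)=\sum_{m\ge1} z^m/m^k$. The poly-Bernoulli numbers $B_n^{(k)}$ are defined by $\frac{\mathrm{Li}_k(1-e^{-x})}{1-e^{-x}}=\sum_{n\ge0}B_n^{(k)}\frac{x^n}{n!}$, and the poly-Bernoulli polynomials $B_n^{(k)}(t)$ by $\frac{\mathrm{Li}_k(1-e^{-x})}{1-e^{-x}}e^{xt}=\sum_{n\ge0}B_n^{(k)}(t)\frac{x^n}{n!}$. For positive reals $a,b$ with $ab\ne1$ and $c>0$, the generalized poly-Bernoulli polynomials $B_n^{(k)}(x;a,b,c)$ are defined by the power series expansion in $t$ (valid for $|t|<2\pi/|\ln a+\ln b|$) $\frac{\mathrm{Li}_k(1-(ab)^{-t})}{b^t-a^{-t}}c^{xt}=\sum_{n\ge0}B_n^{(k)}(x;a,b,c)\frac{t^n}{n!}$.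 *)

theory Defs
  imports Complex_Main
begin

definition polylog :: "int \<Rightarrow> real \<Rightarrow> real" where
  "polylog k z = (\<Sum>m. z ^ Suc m / real (Suc m) powi k)"

text \<open>
  The numbers \<open>B\<^sub>n\<close> with \<open>f t = (\<Sum>n. B\<^sub>n t\<^sup>n / n!)\<close> near \<open>0\<close>. The point \<open>t = 0\<close> itself is
  left out: the generating functions below are of the form \<open>0/0\<close> there (a removable
  singularity), and HOL would evaluate them to \<open>0\<close>. The coefficients are determined by the
  values on a punctured neighbourhood.
\<close>
definition egf_coeff :: "(real \<Rightarrow> real) \<Rightarrow> nat \<Rightarrow> real" where
  "egf_coeff f = (THE B. \<forall>\<^sub>F t in at 0. (\<lambda>n. B n * (t ^ n / fact n)) sums f t)"

definition poly_bernoulli :: "int \<Rightarrow> nat \<Rightarrow> real" where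
  "poly_bernoulli k = egf_coeff (\<lambda>x. polylog k (1 - exp (- x)) / (1 - exp (- x)))"

definition poly_bernoulli_poly :: "int \<Rightarrow> nat \<Rightarrow> real \<Rightarrow> real" where
  "poly_bernoulli_poly k n t =
     egf_coeff (\<lambda>x. polylog k (1 - exp (- x)) / (1 - exp (- x)) * exp (x * t)) n"

definition gen_poly_bernoulli_poly ::
    "int \<Rightarrow> nat \<Rightarrow> real \<Rightarrow> real \<Rightarrow> real \<Rightarrow> real \<Rightarrow> real" where
  "gen_poly_bernoulli_poly k n x a b c =
     egf_coeff (\<lambda>t. polylog k (1 - (a * b) powr (- t)) / (b powr t - a powr (- t))
                     * c powr (x * t)) n"

end

theory Submission
  imports Defs "HOL-Complex_Analysis.Laurent_Convergence"
begin

text \<open>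
  Put \<open>L = ln a + ln b\<close> and let \<open>G x = Li\<^sub>k (1 - e\<^sup>-\<^sup>x) / (1 - e\<^sup>-\<^sup>x)\<close>. Since
  \<open>b\<^sup>t - a\<^sup>-\<^sup>t = b\<^sup>t (1 - e\<^sup>-\<^sup>L\<^sup>t)\<close>, the generating function of the generalized polynomials is
  \<open>G (L t) e\<^bsup>L t s\<^esup> e\<^bsup>t x ln c\<^esup>\<close> with \<open>s = - ln b / L\<close>. Products of exponential generating
  functions correspond to binomial convolutions, so both formulas follow by comparing
  coefficients. The only analytic inputs are that \<open>G\<close> has a power series at \<open>0\<close> and that such
  a series is determined by its values on a punctured neighbourhood.
\<close>

subsection \<open>Exponential generating functions\<close>

definition has_egf :: "('a::{banach, real_normed_field} \<Rightarrow> 'a) \<Rightarrow> (nat \<Rightarrow> 'a) \<Rightarrow> bool" where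
  "has_egf f B \<longleftrightarrow> (\<forall>\<^sub>F t in at 0. (\<lambda>n. B n * (t ^ n / fact n)) sums f t)"

lemma has_egf_transform:
  assumes "has_egf f B" "\<forall>\<^sub>F t in at 0. f t = g t"
  shows "has_egf g B"
  using assms unfolding has_egf_def by eventually_elim simp

lemma powser_eventually_sums_0_imp_eq_0:
  fixes a :: "nat \<Rightarrow> 'a::{banach, real_normed_field}"
  assumes "\<forall>\<^sub>F t in at 0. (\<lambda>n. a n * t ^ n) sums 0"
  shows "a n = 0"
proof (rule ccontr)
  assume "a n \<noteq> 0"
  obtain r where "r > 0" and sums_0: "\<And>t. t \<noteq> 0 \<Longrightarrow> norm t < r \<Longrightarrow> (\<lambda>n. a n * t ^ n) sums 0"
    using assms unfolding eventually_at by (auto simp: dist_norm)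
  have "((\<lambda>_. 0) \<longlongrightarrow> a 0) (at (0::'a))"
    using powser_limit_0_strong[OF \<open>r > 0\<close>, of a "\<lambda>_. 0"] sums_0 by blast
  then have "a 0 = 0"
    by (simp add: tendsto_const_iff)
  then have "n > 0"
    using \<open>a n \<noteq> 0\<close> by (cases n) auto
  have "(\<lambda>n. a n * (t - 0) ^ n) sums 0" if "norm (t - 0) < r" for t
    using that sums_0[of t] powser_sums_zero[of a] \<open>a 0 = 0\<close> by (cases "t = 0") auto
  from powser_0_nonzero[where f = "\<lambda>_. 0", OF \<open>r > 0\<close> this refl \<open>a n \<noteq> 0\<close> \<open>n > 0\<close>]
  obtain s where "s > 0" and nonzero: "\<And>z. z \<in> cball (0::'a) s - {0} \<Longrightarrow> (0::'a) \<noteq> 0"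
    by blast
  have "of_real s \<in> cball (0::'a) s - {0}"
    using \<open>s > 0\<close> by simp
  from nonzero[OF this] show False
    by simp
qed

lemma has_egf_unique:
  assumes "has_egf f A" "has_egf f B"
  shows "A = B"
proof
  fix n
  have "\<forall>\<^sub>F t in at 0. (\<lambda>n. (A n - B n) / fact n * t ^ n) sums 0"
    using assms unfolding has_egf_def
  proof eventually_elim
    case (elim t)
    then show ?case
      using sums_diff[OF elim] by (simp add: field_simps)
  qed
  then have "(A n - B n) / fact n = 0"
    by (rule powser_eventually_sums_0_imp_eq_0)
  then show "A n = B n"
    by simp
qed

lemma egf_coeff_eqI: "has_egf f B \<Longrightarrow> egf_coeff f = B"
  unfolding egf_coeff_def has_egf_def[symmetric]
  by (rule the_equality) (auto intro: has_egf_unique)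

lemma has_egf_egf_coeff: "has_egf f B \<Longrightarrow> has_egf f (egf_coeff f)"
  by (simp add: egf_coeff_eqI)

lemma eventually_nhds_0_norm_less:
  assumes "R > 0"
  shows "\<forall>\<^sub>F z::'a::real_normed_vector in nhds 0. ereal (norm z) < R"
  using eventually_nhds_in_open[of "eball (0::'a) R" 0] assms by (simp add: zero_ereal_def)

lemma has_fps_expansion_imp_eventually_sums:
  assumes "f has_fps_expansion F"
  shows "\<forall>\<^sub>F z in nhds 0. (\<lambda>n. fps_nth F n * z ^ n) sums f z"
proof -
  have "\<forall>\<^sub>F z::'a in nhds 0. ereal (norm z) < fps_conv_radius F"
    using assms by (intro eventually_nhds_0_norm_less) (simp add: has_fps_expansion_def)
  moreover have "\<forall>\<^sub>F z in nhds 0. eval_fps F z = f z"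
    using assms by (simp add: has_fps_expansion_def)
  ultimately show ?thesis
  proof eventually_elim
    case (elim z)
    then show ?case
      using sums_eval_fps[of z F] by simp
  qed
qed

lemma has_fps_expansion_imp_has_egf:
  assumes "f has_fps_expansion F"
  shows "has_egf f (\<lambda>n. fact n * fps_nth F n)"
  using has_fps_expansion_imp_eventually_sums[OF assms]
  unfolding has_egf_def eventually_at_filter by eventually_elim simp

lemma has_egf_imp_has_fps_expansion:
  assumes "has_egf f B"
  shows "f(0 := B 0) has_fps_expansion Abs_fps (\<lambda>n. B n / fact n)"
proof (rule has_fps_expansionI)
  show "\<forall>\<^sub>F t in nhds 0. (\<lambda>n. fps_nth (Abs_fps (\<lambda>n. B n / fact n)) n * t ^ n) sums
          (f(0 := B 0)) t"
    using assms unfolding has_egf_def eventually_at_filter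
  proof eventually_elim
    case (elim t)
    then show ?case
      using powser_sums_zero[of "\<lambda>n. B n / fact n"] by (auto simp: field_simps)
  qed
qed

lemma has_egf_mult:
  assumes "has_egf f A" "has_egf g B"
  shows "has_egf (\<lambda>t. f t * g t) (\<lambda>n. \<Sum>l=0..n. of_nat (n choose l) * A l * B (n - l))"
proof -
  let ?F = "Abs_fps (\<lambda>n. A n / fact n)" and ?G = "Abs_fps (\<lambda>n. B n / fact n)"
  have "has_egf (\<lambda>t. (f(0 := A 0)) t * (g(0 := B 0)) t) (\<lambda>n. fact n * fps_nth (?F * ?G) n)"
    by (intro has_fps_expansion_imp_has_egf has_fps_expansion_mult
              has_egf_imp_has_fps_expansion assms)
  also have "(\<lambda>n. fact n * fps_nth (?F * ?G) n) =
               (\<lambda>n. \<Sum>l=0..n. of_nat (n choose l) * A l * B (n - l))"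
    unfolding fps_mult_nth sum_distrib_left
    by (intro ext sum.cong refl) (simp add: binomial_fact)
  finally show ?thesis
    by (rule has_egf_transform) (simp add: eventually_at_filter)
qed

lemma has_egf_exp: "has_egf (\<lambda>t. exp (s * t)) (\<lambda>n. s ^ n)"
  using has_fps_expansion_imp_has_egf[OF has_fps_expansion_exp[of s]] by simp

lemma has_egf_scale:
  assumes "has_egf f B" "s \<noteq> 0"
  shows "has_egf (\<lambda>t. f (s * t)) (\<lambda>n. s ^ n * B n)"
proof -
  have "filterlim (\<lambda>t. s * t) (at 0) (at 0)"
    using assms(2) by (auto simp: filterlim_at eventually_at_filter intro!: tendsto_eq_intros)
  from eventually_compose_filterlim[OF assms(1)[unfolded has_egf_def] this]
  show ?thesis
    unfolding has_egf_def by eventually_elim (simp add: power_mult_distrib mult_ac)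
qed


subsection \<open>Composition of real power series\<close>

definition fps_of_real :: "real fps \<Rightarrow> 'a::real_algebra_1 fps" where
  "fps_of_real F = Abs_fps (\<lambda>n. of_real (fps_nth F n))"

lemma fps_nth_of_real [simp]: "fps_nth (fps_of_real F) n = of_real (fps_nth F n)"
  by (simp add: fps_of_real_def)

lemma fps_of_real_power: "fps_of_real (F ^ n) = fps_of_real F ^ n"
  by (induction n) (simp_all add: fps_eq_iff fps_mult_nth)

lemma fps_of_real_compose:
  "fps_of_real (fps_compose F G) = fps_compose (fps_of_real F) (fps_of_real G)"
  by (simp add: fps_eq_iff fps_compose_nth flip: fps_of_real_power)

lemma fps_conv_radius_of_real [simp]:
  "fps_conv_radius (fps_of_real F :: 'a::{banach, real_normed_div_algebra} fps) = fps_conv_radius F"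
  by (simp add: fps_conv_radius_def conv_radius_def)

lemma eval_fps_of_real:
  assumes "ereal \<bar>x\<bar> < fps_conv_radius F"
  shows "eval_fps (fps_of_real F) (of_real x :: 'a::{banach, real_normed_div_algebra}) =
           of_real (eval_fps F x)"
proof -
  have "(\<lambda>n. of_real (fps_nth F n * x ^ n) :: 'a) sums of_real (eval_fps F x)"
    using assms by (intro sums_of_real sums_eval_fps) simp
  then show ?thesis
    by (simp add: eval_fps_def sums_iff)
qed

lemma has_fps_expansion_imp_eventually_eval_fps_of_real:
  assumes "f has_fps_expansion F"
  shows "\<forall>\<^sub>F x in nhds 0. eval_fps (fps_of_real F)
           (of_real x :: 'a::{banach, real_normed_div_algebra}) = of_real (f x)"
proof -
  have "\<forall>\<^sub>F x::real in nhds 0. ereal (norm x) < fps_conv_radius F"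
    using assms by (intro eventually_nhds_0_norm_less) (simp add: has_fps_expansion_def)
  moreover have "\<forall>\<^sub>F x in nhds 0. eval_fps F x = f x"
    using assms by (simp add: has_fps_expansion_def)
  ultimately show ?thesis
    by eventually_elim (simp add: eval_fps_of_real)
qed

lemma has_fps_expansion_imp_tendsto_nth_0:
  fixes f :: "'a::{banach, real_normed_field} \<Rightarrow> 'a"
  assumes "f has_fps_expansion F"
  shows "filterlim f (nhds (fps_nth F 0)) (nhds 0)"
  using has_fps_expansion_imp_continuous[OF assms, of UNIV]
    has_fps_expansion_imp_0_eq_fps_nth_0[OF assms]
  by (simp add: isCont_def tendsto_nhds_iff)

text \<open>The library states the composition rule over the complex numbers only.\<close>

lemma has_fps_expansion_compose_real:
  fixes f g :: "real \<Rightarrow> real"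
  assumes f: "f has_fps_expansion F"
    and g: "g has_fps_expansion G" "fps_nth G 0 = 0"
  shows "(\<lambda>x. f (g x)) has_fps_expansion fps_compose F G"
proof -
  let ?H = "fps_compose F G"
  have "(eval_fps (fps_of_real F) \<circ> eval_fps (fps_of_real G)) has_fps_expansion
          (fps_of_real ?H :: complex fps)"
    unfolding fps_of_real_compose using f g
    by (intro has_fps_expansion_compose eval_fps_has_fps_expansion)
      (simp_all add: has_fps_expansion_def)
  then have radius_H: "fps_conv_radius ?H > 0"
    and compose: "\<forall>\<^sub>F z in nhds (0::complex). eval_fps (fps_of_real ?H) z =
           eval_fps (fps_of_real F) (eval_fps (fps_of_real G) z)"
    by (simp_all add: has_fps_expansion_def)
  have of_real_0: "filterlim complex_of_real (nhds 0) (nhds 0)"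
    using tendsto_of_real[OF filterlim_ident, of "0::real"] by simp
  have g_0: "filterlim g (nhds 0) (nhds 0)"
    using has_fps_expansion_imp_tendsto_nth_0[OF g(1)] g(2) by simp
  note of_real_eval = has_fps_expansion_imp_eventually_eval_fps_of_real[where ?'a = complex]
  have "\<forall>\<^sub>F x in nhds 0. eval_fps ?H x = f (g x)"
    using eventually_compose_filterlim[OF compose of_real_0]
      of_real_eval[OF eval_fps_has_fps_expansion[OF radius_H]] of_real_eval[OF g(1)]
      eventually_compose_filterlim[OF of_real_eval[OF f] g_0]
  proof eventually_elim
    case (elim x)
    then have "complex_of_real (eval_fps ?H x) = of_real (f (g x))"
      by simp
    then show ?case
      by (simp only: of_real_eq_iff)
  qed
  with radius_H show ?thesis
    by (simp add: has_fps_expansion_def)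
qed


subsection \<open>Poly-Bernoulli polynomials\<close>

definition polylog_div_fps :: "int \<Rightarrow> real fps" where
  "polylog_div_fps k = Abs_fps (\<lambda>m. 1 / real (Suc m) powi k)"

lemma fps_conv_radius_polylog_div_fps: "fps_conv_radius (polylog_div_fps k) = 1"
  unfolding fps_conv_radius_def
proof (rule conv_radius_ratio_limit_nonzero[of _ 1])
  have "(\<lambda>m. real (Suc (Suc m)) / real (Suc m)) \<longlonglongrightarrow> 1"
    by (rule filterlim_compose[OF LIMSEQ_Suc_n_over_n filterlim_Suc])
  then have "(\<lambda>m. (real (Suc (Suc m)) / real (Suc m)) powi k) \<longlonglongrightarrow> 1 powi k"
    by (intro tendsto_power_int) auto
  then show "(\<lambda>m. norm (fps_nth (polylog_div_fps k) m) /
                norm (fps_nth (polylog_div_fps k) (Suc m))) \<longlonglongrightarrow> 1"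
    by (simp add: polylog_div_fps_def norm_power_int power_int_divide_distrib flip: of_nat_Suc)
qed (auto simp: one_ereal_def)

lemma polylog_eq_eval_fps:
  assumes "\<bar>z\<bar> < 1"
  shows "polylog k z = z * eval_fps (polylog_div_fps k) z"
proof -
  have "(\<lambda>m. z * (fps_nth (polylog_div_fps k) m * z ^ m)) sums
          (z * eval_fps (polylog_div_fps k) z)"
    using assms by (intro sums_mult sums_eval_fps) (simp add: fps_conv_radius_polylog_div_fps)
  then show ?thesis
    by (simp add: polylog_def polylog_div_fps_def sums_iff)
qed

definition poly_bernoulli_gf :: "int \<Rightarrow> real \<Rightarrow> real" where
  "poly_bernoulli_gf k x = polylog k (1 - exp (- x)) / (1 - exp (- x))"

lemma has_egf_poly_bernoulli: "has_egf (poly_bernoulli_gf k) (poly_bernoulli k)"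
proof -
  have "(\<lambda>x::real. 1 - exp (- x)) has_fps_expansion 1 - fps_exp (- 1)"
    by (intro fps_expansion_intros)
  then have "(\<lambda>x. eval_fps (polylog_div_fps k) (1 - exp (- x))) has_fps_expansion
               fps_compose (polylog_div_fps k) (1 - fps_exp (- 1))"
    by (intro has_fps_expansion_compose_real eval_fps_has_fps_expansion)
      (simp_all add: fps_conv_radius_polylog_div_fps)
  then obtain B where B: "has_egf (\<lambda>x. eval_fps (polylog_div_fps k) (1 - exp (- x))) B"
    using has_fps_expansion_imp_has_egf by blast
  have "((\<lambda>x::real. \<bar>1 - exp (- x)\<bar>) \<longlongrightarrow> 0) (at 0)"
    by (auto intro!: tendsto_eq_intros)
  then have "\<forall>\<^sub>F x::real in at 0. \<bar>1 - exp (- x)\<bar> < 1"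
    by (rule order_tendstoD) simp
  moreover have "\<forall>\<^sub>F x::real in at 0. x \<noteq> 0"
    by (simp add: eventually_at_filter)
  ultimately have "\<forall>\<^sub>F x in at 0. eval_fps (polylog_div_fps k) (1 - exp (- x)) =
      poly_bernoulli_gf k x"
    by eventually_elim (simp add: poly_bernoulli_gf_def polylog_eq_eval_fps)
  then have "has_egf (poly_bernoulli_gf k) B"
    by (rule has_egf_transform[OF B])
  from has_egf_egf_coeff[OF this] show ?thesis
    unfolding poly_bernoulli_def poly_bernoulli_gf_def .
qed

lemma has_egf_poly_bernoulli_poly:
  "has_egf (\<lambda>x. poly_bernoulli_gf k x * exp (s * x)) (\<lambda>n. poly_bernoulli_poly k n s)"
  using has_egf_egf_coeff[OF has_egf_mult[OF has_egf_poly_bernoulli has_egf_exp[of s]]]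
  unfolding poly_bernoulli_poly_def poly_bernoulli_gf_def mult.commute[of s] .

lemma poly_bernoulli_poly_eq_sum:
  "poly_bernoulli_poly k n s =
     (\<Sum>j=0..n. real (n choose j) * poly_bernoulli k j * s ^ (n - j))"
  by (rule fun_cong[OF has_egf_unique[OF has_egf_poly_bernoulli_poly
        has_egf_mult[OF has_egf_poly_bernoulli has_egf_exp]]])

lemma power_mult_poly_bernoulli_poly_divide:
  assumes "L \<noteq> 0"
  shows "L ^ n * poly_bernoulli_poly k n (y / L) =
           (\<Sum>j=0..n. real (n choose j) * L ^ j * poly_bernoulli k j * y ^ (n - j))"
  unfolding poly_bernoulli_poly_eq_sum sum_distrib_left
proof (intro sum.cong refl)
  fix j assume "j \<in> {0..n}"
  then have "L ^ n = L ^ j * L ^ (n - j)"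
    by (simp flip: power_add)
  then show "L ^ n * (real (n choose j) * poly_bernoulli k j * (y / L) ^ (n - j)) =
               real (n choose j) * L ^ j * poly_bernoulli k j * y ^ (n - j)"
    using assms by (simp add: power_divide)
qed

lemma ln_add_ln_eq_0_iff:
  fixes a b :: real
  assumes "a > 0" "b > 0"
  shows "ln a + ln b = 0 \<longleftrightarrow> a * b = 1"
  using assms by (simp flip: ln_mult_pos)

lemma gen_poly_bernoulli_gf_eq:
  fixes a b c :: real
  assumes "a > 0" "b > 0" "c > 0"
  shows "polylog k (1 - (a * b) powr (- t)) / (b powr t - a powr (- t)) * c powr (x * t) =
           poly_bernoulli_gf k ((ln a + ln b) * t) * exp (- ln b * t) * exp (x * ln c * t)"
proof -
  let ?q = "exp (- ((ln a + ln b) * t))"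
  have "(a * b) powr (- t) = ?q"
    using assms by (simp add: powr_def ln_mult mult.commute)
  moreover have "b powr t - a powr (- t) = (1 - ?q) / exp (- ln b * t)"
    using assms by (simp add: powr_def field_simps flip: exp_add)
  moreover have "c powr (x * t) = exp (x * ln c * t)"
    using assms by (simp add: powr_def mult_ac)
  ultimately show ?thesis
    by (simp add: poly_bernoulli_gf_def)
qed

lemma gen_poly_bernoulli_poly_eq_sum:
  fixes a b c :: real
  assumes "a > 0" "b > 0" "c > 0" "a * b \<noteq> 1"
  defines "L \<equiv> ln a + ln b"
  shows "gen_poly_bernoulli_poly k n x a b c =
           (\<Sum>l=0..n. real (n choose l) * (L ^ l * poly_bernoulli_poly k l (- ln b / L))
              * (x * ln c) ^ (n - l))"
proof -
  have "L \<noteq> 0"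
    using assms by (simp add: ln_add_ln_eq_0_iff)
  have "has_egf
          (\<lambda>t. poly_bernoulli_gf k (L * t) * exp (- ln b / L * (L * t)) * exp (x * ln c * t))
          (\<lambda>n. \<Sum>l=0..n. real (n choose l) * (L ^ l * poly_bernoulli_poly k l (- ln b / L))
             * (x * ln c) ^ (n - l))"
    by (intro has_egf_mult has_egf_exp has_egf_scale[OF has_egf_poly_bernoulli_poly \<open>L \<noteq> 0\<close>])
  moreover have "- ln b / L * (L * t) = - ln b * t" for t
    using \<open>L \<noteq> 0\<close> by simp
  ultimately show ?thesis
    unfolding gen_poly_bernoulli_poly_def gen_poly_bernoulli_gf_eq[OF assms(1-3), folded L_def]
    by (simp only: egf_coeff_eqI)
qed

theorem theorem3:
  fixes k :: int and n :: nat and x a b c :: real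
  assumes "a > 0" and "b > 0" and "c > 0"
    and "a \<noteq> b" and "b > a" and "a * b \<noteq> 1"
  shows "gen_poly_bernoulli_poly k n x a b c =
           (\<Sum>l=0..n. real (n choose l) * ln c ^ (n - l) * (ln a + ln b) ^ l
              * poly_bernoulli_poly k l (- ln b / (ln a + ln b)) * x ^ (n - l))
       \<and> gen_poly_bernoulli_poly k n x a b c =
           (\<Sum>l=0..n. \<Sum>j=0..l. (- 1) ^ (l - j) * real (n choose l) * real (l choose j)
              * ln c ^ (n - l) * ln b ^ (l - j) * (ln a + ln b) ^ j
              * poly_bernoulli k j * x ^ (n - l))"
proof
  note eq_sum = gen_poly_bernoulli_poly_eq_sum[OF \<open>a > 0\<close> \<open>b > 0\<close> \<open>c > 0\<close> \<open>a * b \<noteq> 1\<close>]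
  show "gen_poly_bernoulli_poly k n x a b c =
          (\<Sum>l=0..n. real (n choose l) * ln c ^ (n - l) * (ln a + ln b) ^ l
             * poly_bernoulli_poly k l (- ln b / (ln a + ln b)) * x ^ (n - l))"
    by (simp add: eq_sum power_mult_distrib mult_ac)
  have "ln a + ln b \<noteq> 0"
    using assms by (simp add: ln_add_ln_eq_0_iff)
  note eq_sum[unfolded power_mult_poly_bernoulli_poly_divide[OF this]]
  also have "(\<Sum>l=0..n. real (n choose l) * (\<Sum>j=0..l. real (l choose j) * (ln a + ln b) ^ j
                 * poly_bernoulli k j * (- ln b) ^ (l - j)) * (x * ln c) ^ (n - l)) =
               (\<Sum>l=0..n. \<Sum>j=0..l. (- 1) ^ (l - j) * real (n choose l) * real (l choose j)
                 * ln c ^ (n - l) * ln b ^ (l - j) * (ln a + ln b) ^ j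
                 * poly_bernoulli k j * x ^ (n - l))"
    unfolding power_minus[of "ln b"]
    by (simp only: sum_distrib_left sum_distrib_right power_mult_distrib mult_ac)
  finally show "gen_poly_bernoulli_poly k n x a b c =
      (\<Sum>l=0..n. \<Sum>j=0..l. (- 1) ^ (l - j) * real (n choose l) * real (l choose j)
         * ln c ^ (n - l) * ln b ^ (l - j) * (ln a + ln b) ^ j
         * poly_bernoulli k j * x ^ (n - l))" .
qed

end
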